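(* Let $G$ be a finite simple undirected graph on $n\ge 2$ vertices, with complement $\overline G$. For every $\sigma\in\{+,-\}$, $$s^\sigma(G)+s^\sigma(\overline G)\le (n-1)^2.$$ For $\sigma=+$, equality holds if and only if $G$ is complete or edgeless. For $\sigma=-$, equality holds if and only if $n=2$.
   Context: All graphs are finite, simple, and undirected. For a graph $G$ with $n$ vertices and adjacency matrix $A=A(G)$, let $\lambda_1,\ldots,\lambda_n$ be the (real) eigenvalues of $A$, counted with multiplicity. The positive square energy and the negative square energy of $G$ are $$s^+(G):=\sum_{\lambda_i>0}\lambda_i^2,\qquad s^-(G):=\sum_{\lambda_i<0}\lambda_i^2.$$ $\overline G$ denotes the complement of $G$: the graph on the same vertex set in which two distinct vertices are adjacent if and only if they are not adjacent in $G$. *)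

theory Defs
  imports
    "Graph_Theory.Graph_Theory"
    "Jordan_Normal_Form.Char_Poly"
    "HOL-Computational_Algebra.Polynomial"
begin

text \<open>
  A finite simple undirected graph is a \<open>pair_graph\<close>: finite vertex set, and an irreflexive
  symmetric set of ordered pairs in which an edge between u and v contributes both (u, v) and (v, u).
\<close>

definition graph_complement :: "'a pair_pre_digraph \<Rightarrow> 'a pair_pre_digraph" where
  "graph_complement G =
     \<lparr> pverts = pverts G,
       parcs = {(u, v). u \<in> pverts G \<and> v \<in> pverts G \<and> u \<noteq> v \<and> (u, v) \<notin> parcs G} \<rparr>"

definition edgeless :: "'a pair_pre_digraph \<Rightarrow> bool" where
  "edgeless G \<longleftrightarrow> parcs G = {}"

text \<open>
  Matrices are indexed by \<open>0, \<dots>, n - 1\<close>, so the adjacency matrix needs an enumeration of the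
  vertices. An arbitrary one is chosen; a different choice conjugates the matrix by a permutation
  matrix and leaves the characteristic polynomial unchanged.
\<close>

definition vertex_enum :: "'a pair_pre_digraph \<Rightarrow> 'a list" where
  "vertex_enum G = (SOME vs. distinct vs \<and> set vs = pverts G)"

definition adjacency_matrix :: "'a pair_pre_digraph \<Rightarrow> real mat" where
  "adjacency_matrix G =
     (let vs = vertex_enum G
      in mat (length vs) (length vs) (\<lambda>(i, j). if (vs ! i, vs ! j) \<in> parcs G then 1 else 0))"

text \<open>
  The eigenvalues with algebraic multiplicity, as the multiset of real roots of the characteristic
  polynomial. The adjacency matrix is real symmetric, so there are no other complex roots.
\<close>

definition graph_eigenvalues :: "'a pair_pre_digraph \<Rightarrow> real multiset" where
  "graph_eigenvalues G = proots (char_poly (adjacency_matrix G))"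

definition pos_square_energy :: "'a pair_pre_digraph \<Rightarrow> real" where
  "pos_square_energy G = (\<Sum>l \<in># filter_mset (\<lambda>l. l > 0) (graph_eigenvalues G). l\<^sup>2)"

definition neg_square_energy :: "'a pair_pre_digraph \<Rightarrow> real" where
  "neg_square_energy G = (\<Sum>l \<in># filter_mset (\<lambda>l. l < 0) (graph_eigenvalues G). l\<^sup>2)"

end

theory Submission
  imports
    Defs
    "HOL-Analysis.Convex"
    "Jordan_Normal_Form.Schur_Decomposition"
    "Jordan_Normal_Form.Spectral_Radius"
begin

text \<open>
  The spectral theorem splits the adjacency matrix as \<open>A = P - N\<close>, where \<open>P\<close> and \<open>N\<close> are positive
  semidefinite, are orthogonal for the Frobenius inner product, and have squared Frobenius norms
  \<open>s\<^sup>+\<close> and \<open>s\<^sup>-\<close> (lemma \<open>symmetric_mat_pos_neg_parts\<close>). Since \<open>A\<close> has a zero diagonal, \<open>P\<close> and \<open>N\<close>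
  have the same diagonal. These facts alone force \<open>s\<^sup>+ \<le> (n - 1) s\<^sup>-\<close> and, by symmetry,
  \<open>s\<^sup>- \<le> (n - 1) s\<^sup>+\<close> (lemma \<open>gram_orthogonal_le\<close>).

  As \<open>s\<^sup>+ + s\<^sup>-\<close> is the squared norm of \<open>A\<close>, that is, the number \<open>d\<close> of arcs, both bounds read
  \<open>n s\<^sup>\<sigma> \<le> (n - 1) d\<close>. A graph and its complement have \<open>n (n - 1)\<close> arcs together, so adding the two
  inequalities gives \<open>(n - 1)\<^sup>2\<close>.

  Equality in the sum means equality for each of the two graphs. Equality for one of them makes every
  off-diagonal entry of \<open>P - N\<close> nonzero unless \<open>A = 0\<close> (lemma \<open>gram_orthogonal_eq_imp\<close>), so the graph
  is complete or edgeless. Conversely, testing \<open>P\<close> against the all-ones matrix gives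
  \<open>s\<^sup>+ \<ge> (n - 1)\<^sup>2\<close> for the complete graph. So the positive sum attains the bound exactly at complete
  and edgeless graphs, and there the negative sum is \<open>n (n - 1) - (n - 1)\<^sup>2 = n - 1\<close>, which is
  \<open>(n - 1)\<^sup>2\<close> only for \<open>n = 2\<close>.
\<close>

section \<open>The spectral theorem for real symmetric matrices\<close>

unbundle no inner_syntax


text \<open>
  A complex eigenvalue \<open>z\<close> with eigenvector \<open>w\<close> exists. Moving the symmetric matrix across the
  Hermitian product of \<open>w\<close> with itself shows \<open>z = cnj z\<close>, so \<open>z\<close> is a real root of the
  characteristic polynomial.
\<close>
lemma symmetric_mat_has_real_eigenvector:
  fixes A :: "real mat"
  assumes A: "A \<in> carrier_mat n n" and sym: "transpose_mat A = A" and n: "n \<noteq> 0"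
  shows "\<exists>v e. eigenvector A v e"
proof -
  define C where "C = map_mat complex_of_real A"
  have C: "C \<in> carrier_mat n n" and C_sym: "transpose_mat C = C"
    using A arg_cong[OF sym, of "map_mat complex_of_real"]
    by (auto simp: C_def map_mat_transpose)
  obtain z w where "eigenvector C w z"
    using spectrum_non_empty[OF C] n by (auto simp: spectrum_def eigenvalue_def)
  then have w: "w \<in> carrier_vec n" "w \<noteq> 0\<^sub>v n" and Cw: "C *\<^sub>v w = z \<cdot>\<^sub>v w"
    using C by (auto simp: eigenvector_def)
  have C_cnj: "C *\<^sub>v conjugate w = cnj z \<cdot>\<^sub>v conjugate w"
  proof -
    have "C *\<^sub>v conjugate w = conjugate (C *\<^sub>v w)"
      using A w by (intro eq_vecI) (auto simp: C_def scalar_prod_def)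
    then show ?thesis unfolding Cw by (auto intro!: eq_vecI)
  qed
  have "z * (w \<bullet>c w) = (C *\<^sub>v w) \<bullet>c w"
    using w Cw by simp
  also have "\<dots> = w \<bullet> (C *\<^sub>v conjugate w)"
    using transpose_vec_mult_scalar[OF C, of w "conjugate w"] w C_sym
    by (smt (verit, best) carrier_vec_conjugate C comm_scalar_prod mult_mat_vec_carrier)
  also have "\<dots> = cnj z * (w \<bullet>c w)"
    using w C_cnj by simp
  finally have "z = cnj z"
    using w by simp
  then have z: "z = of_real (Re z)"
    by (simp add: complex_eq_iff)
  have "poly (char_poly C) z = 0"
    using \<open>eigenvector C w z\<close> eigenvalue_root_char_poly[OF C] by (auto simp: eigenvalue_def)
  then have "poly (map_poly of_real (char_poly A)) (complex_of_real (Re z)) = 0"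
    using z by (simp add: C_def of_real_hom.char_poly_hom[OF A])
  then have "poly (char_poly A) (Re z) = 0"
    by simp
  then show ?thesis
    using eigenvalue_root_char_poly[OF A] unfolding eigenvalue_def by blast
qed

text \<open>
  Gram-Schmidt keeps the first vector of a basis, and normalising the resulting columns turns their
  orthogonality into orthonormality.
\<close>
lemma ex_orthogonal_mat_with_first_col:
  fixes v :: "real vec"
  assumes v: "v \<in> carrier_vec n" "v \<noteq> 0\<^sub>v n" and n: "n \<noteq> 0"
  shows "\<exists>W c. W \<in> carrier_mat n n \<and> transpose_mat W * W = 1\<^sub>m n \<and> col W 0 = c \<cdot>\<^sub>v v"
proof -
  interpret cof_vec_space n "TYPE(real)" .
  define ws where "ws = gram_schmidt n (basis_completion v)"
  note basis = basis_completion[OF v]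
  have ws: "set ws \<subseteq> carrier_vec n" "corthogonal ws" "length ws = n"
    using gram_schmidt_result[OF basis(2,4,5) ws_def] basis(6) by auto
  obtain vs where "basis_completion v = v # vs"
    using basis(6,7) n by (cases "basis_completion v") auto
  then have ws0: "ws ! 0 = v"
    using gram_schmidt_hd[OF v(1), of vs] ws(3) n by (metis hd_conv_nth length_0_conv ws_def)
  have nth_carrier: "ws ! i \<in> carrier_vec n" if "i < n" for i
    using ws that by (simp add: subset_iff)
  have orth: "ws ! i \<bullet> ws ! j = 0 \<longleftrightarrow> i \<noteq> j" if "i < n" "j < n" for i j
    using corthogonalD[OF ws(2)] that ws(3) by simp
  define f where "f w = (1 / sqrt (w \<bullet> w)) \<cdot>\<^sub>v w" for w :: "real vec"
  define W where "W = mat_of_cols n (map f ws)"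
  have W: "W \<in> carrier_mat n n"
    using ws(3) by (auto simp: W_def)
  have colW: "col W i = f (ws ! i)" if "i < n" for i
    using that ws(3) nth_carrier[OF that] by (simp add: W_def f_def)
  have "transpose_mat W * W = 1\<^sub>m n"
  proof (rule eq_matI)
    fix i j assume "i < dim_row (1\<^sub>m n :: real mat)" "j < dim_col (1\<^sub>m n :: real mat)"
    then have ij: "i < n" "j < n" by auto
    have pos: "ws ! i \<bullet> ws ! i > 0"
    proof -
      have "ws ! i \<bullet> ws ! i \<noteq> 0" using orth ij by blast
      moreover have "ws ! i \<bullet> ws ! i \<ge> 0" by (auto simp: scalar_prod_def intro: sum_nonneg)
      ultimately show ?thesis by simp
    qed
    have "(transpose_mat W * W) $$ (i, j) = f (ws ! i) \<bullet> f (ws ! j)"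
      using ij W colW by auto
    also have "\<dots> = (1 / sqrt (ws ! i \<bullet> ws ! i)) * (1 / sqrt (ws ! j \<bullet> ws ! j)) * (ws ! i \<bullet> ws ! j)"
      using nth_carrier[OF ij(1)] nth_carrier[OF ij(2)]
      by (simp add: f_def smult_scalar_prod_distrib[where n = n] scalar_prod_smult_distrib[where n = n])
    also have "\<dots> = 1\<^sub>m n $$ (i, j)"
      using orth[of i j] ij pos by (cases "i = j") (auto simp: field_simps)
    finally show "(transpose_mat W * W) $$ (i, j) = 1\<^sub>m n $$ (i, j)" .
  qed (use W in auto)
  moreover have "col W 0 = (1 / sqrt (v \<bullet> v)) \<cdot>\<^sub>v v"
    using colW[of 0] n ws0 by (simp add: f_def)
  ultimately show ?thesis using W by blast
qed

text \<open>
  By induction on the dimension. Conjugating by an orthogonal matrix whose first column is an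
  eigenvector clears the first column below the diagonal, hence by symmetry also the rest of the first row, and leaves a symmetric
  block of size one less. The characteristic polynomial is carried along so that the diagonal
  entries are the eigenvalues with the correct multiplicity.
\<close>
theorem real_spectral_theorem:
  fixes A :: "real mat"
  assumes "A \<in> carrier_mat n n" and "transpose_mat A = A"
  shows "\<exists>U es. U \<in> carrier_mat n n \<and> length es = n \<and> transpose_mat U * U = 1\<^sub>m n
    \<and> A = U * mat_diag n (\<lambda>k. es ! k) * transpose_mat U
    \<and> char_poly A = (\<Prod>e\<leftarrow>es. [:- e, 1:])"
  using assms
proof (induction n arbitrary: A)
  case 0
  then show ?case
    by (intro exI[of _ "1\<^sub>m 0"] exI[of _ "[]"])
       (use 0 degree_monic_char_poly[of A 0] in \<open>auto simp: monic_degree_0 char_poly_defs\<close>)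
next
  case (Suc n A)
  have A: "A \<in> carrier_mat (Suc n) (Suc n)" by fact
  obtain v e where "eigenvector A v e"
    using symmetric_mat_has_real_eigenvector[OF Suc.prems] by auto
  then have v: "v \<in> carrier_vec (Suc n)" "v \<noteq> 0\<^sub>v (Suc n)" and Av: "A *\<^sub>v v = e \<cdot>\<^sub>v v"
    using A by (auto simp: eigenvector_def)
  obtain W c where W: "W \<in> carrier_mat (Suc n) (Suc n)" and WtW: "transpose_mat W * W = 1\<^sub>m (Suc n)"
    and colW: "col W 0 = c \<cdot>\<^sub>v v"
    using ex_orthogonal_mat_with_first_col[OF v] by blast
  have WWt: "W * transpose_mat W = 1\<^sub>m (Suc n)"
    using mat_mult_left_right_inverse[OF _ W WtW] W by auto
  define B where "B = transpose_mat W * A * W"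
  have B: "B \<in> carrier_mat (Suc n) (Suc n)"
    using A W by (auto simp: B_def)
  have B_sym: "transpose_mat B = B"
    using A W Suc.prems(2) by (simp add: B_def transpose_mult[of _ "Suc n" "Suc n" _ "Suc n"] assoc_mult_mat[of _ "Suc n" "Suc n" _ "Suc n" _ "Suc n"])
  have colB: "B $$ (i, 0) = (if i = 0 then e else 0)" if i: "i < Suc n" for i
  proof -
    have "B $$ (i, 0) = col W i \<bullet> col (A * W) 0"
      using A W i by (simp add: B_def assoc_mult_mat[of _ "Suc n" "Suc n" _ "Suc n" _ "Suc n"])
    also have "col (A * W) 0 = A *\<^sub>v col W 0"
      using A W by auto
    also have "\<dots> = e \<cdot>\<^sub>v col W 0"
      using A v Av by (simp add: colW mult_mat_vec smult_smult_assoc mult.commute)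
    also have "col W i \<bullet> (e \<cdot>\<^sub>v col W 0) = e * (transpose_mat W * W) $$ (i, 0)"
      using W i by simp
    finally show ?thesis using i by (simp add: WtW)
  qed
  define A' where "A' = mat n n (\<lambda>(i, j). B $$ (Suc i, Suc j))"
  have A': "A' \<in> carrier_mat n n" by (simp add: A'_def)
  have B_at: "B $$ (i, j) = B $$ (j, i)" if "i < Suc n" "j < Suc n" for i j
    using that B arg_cong[OF B_sym, of "\<lambda>M. M $$ (j, i)"] by simp
  have A'_sym: "transpose_mat A' = A'"
    by (rule eq_matI) (auto simp: A'_def B_at)
  have B_block: "B = four_block_mat (mat 1 1 (\<lambda>_. e)) (0\<^sub>m 1 n) (0\<^sub>m n 1) A'"
    by (rule eq_matI) (use B B_at colB in \<open>auto simp: A'_def\<close>)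
  obtain U' es where U': "U' \<in> carrier_mat n n" "length es = n" "transpose_mat U' * U' = 1\<^sub>m n"
    and A'_eq: "A' = U' * mat_diag n (\<lambda>k. es ! k) * transpose_mat U'"
    and cp': "char_poly A' = (\<Prod>e\<leftarrow>es. [:- e, 1:])"
    using Suc.IH[OF A' A'_sym] by blast
  define V where "V = four_block_mat (1\<^sub>m 1) (0\<^sub>m 1 n) (0\<^sub>m n 1) U'"
  have V: "V \<in> carrier_mat (Suc n) (Suc n)"
    using U' by (auto simp: V_def)
  have Vt: "transpose_mat V = four_block_mat (1\<^sub>m 1) (0\<^sub>m 1 n) (0\<^sub>m n 1) (transpose_mat U')"
    unfolding V_def by (subst transpose_four_block_mat) (use U' in auto)
  have VtV: "transpose_mat V * V = 1\<^sub>m (Suc n)"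
    unfolding Vt unfolding V_def
    by (subst mult_four_block_mat) (use U' in \<open>auto intro!: eq_matI\<close>)
  have diag: "mat_diag (Suc n) (\<lambda>k. (e # es) ! k) =
      four_block_mat (mat 1 1 (\<lambda>_. e)) (0\<^sub>m 1 n) (0\<^sub>m n 1) (mat_diag n (\<lambda>k. es ! k))"
    by (rule eq_matI) (auto simp: mat_diag_def nth_Cons')
  have VD: "V * mat_diag (Suc n) (\<lambda>k. (e # es) ! k) =
      four_block_mat (mat 1 1 (\<lambda>_. e)) (0\<^sub>m 1 n) (0\<^sub>m n 1) (U' * mat_diag n (\<lambda>k. es ! k))"
    unfolding diag V_def
    by (subst mult_four_block_mat)
       (use U' left_mult_zero_mat[OF mat_diag_dim[of n "(!) es"], of "Suc 0"] in \<open>auto intro!: cong_four_block_mat\<close>)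
  have B_eq: "B = V * mat_diag (Suc n) (\<lambda>k. (e # es) ! k) * transpose_mat V"
    unfolding VD Vt B_block A'_eq
    by (subst mult_four_block_mat[of _ 1 1 _ n _ n]) (use U' in \<open>auto intro!: cong_four_block_mat\<close>)
  define U where "U = W * V"
  have U: "U \<in> carrier_mat (Suc n) (Suc n)"
    using W V by (auto simp: U_def)
  note assoc = assoc_mult_mat[of _ "Suc n" "Suc n" _ "Suc n" _ "Suc n"]
  have UtU: "transpose_mat U * U = 1\<^sub>m (Suc n)"
  proof -
    have "transpose_mat U * U = transpose_mat V * (transpose_mat W * W) * V"
      using W V by (simp add: U_def transpose_mult[OF W V] assoc)
    then show ?thesis using V by (simp add: WtW VtV)
  qed
  have A_eq: "A = W * B * transpose_mat W"
  proof -
    have "W * B * transpose_mat W = (W * transpose_mat W) * A * (W * transpose_mat W)"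
      using A W by (simp add: B_def assoc)
    then show ?thesis using A by (simp add: WWt)
  qed
  have "A = U * mat_diag (Suc n) (\<lambda>k. (e # es) ! k) * transpose_mat U"
  proof -
    define D where "D = mat_diag (Suc n) (\<lambda>k. (e # es) ! k)"
    have "D \<in> carrier_mat (Suc n) (Suc n)" by (simp add: D_def)
    then show ?thesis
      unfolding A_eq B_eq U_def transpose_mult[OF W V] D_def[symmetric] using W V by (simp add: assoc)
  qed
  moreover have "char_poly A = (\<Prod>e\<leftarrow>e # es. [:- e, 1:])"
  proof -
    have "similar_mat_wit A B W (transpose_mat W)"
      using A B W WWt WtW A_eq by (intro similar_mat_witI) auto
    then have "char_poly A = char_poly B"
      by (intro char_poly_similar) (auto simp: similar_mat_def)
    also have "\<dots> = char_poly (mat 1 1 (\<lambda>_. e)) * char_poly A'"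
      unfolding B_block by (rule char_poly_four_block_zeros_col) (auto simp: A')
    also have "char_poly (mat 1 1 (\<lambda>_. e)) = [:- e, 1:]"
      by (simp add: char_poly_defs det_def sign_def)
    finally show ?thesis by (simp add: cp')
  qed
  ultimately show ?case
    using U UtU U'(2) by (intro exI[of _ U] exI[of _ "e # es"]) auto
qed


section \<open>Positive and negative parts\<close>

text \<open>
  Positive semidefiniteness of the leading \<open>n\<close> by \<open>n\<close> block, in the form that yields the bound on
  the entries and the sign of the quadratic form by one application of Cauchy-Schwarz or one
  completed square.
\<close>
definition is_gram :: "nat \<Rightarrow> (nat \<Rightarrow> nat \<Rightarrow> real) \<Rightarrow> bool" where
  "is_gram n P \<longleftrightarrow> (\<exists>W. \<forall>i<n. \<forall>j<n. P i j = (\<Sum>k<n. W k i * W k j))"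

definition frob_inner :: "nat \<Rightarrow> (nat \<Rightarrow> nat \<Rightarrow> real) \<Rightarrow> (nat \<Rightarrow> nat \<Rightarrow> real) \<Rightarrow> real" where
  "frob_inner n P Q = (\<Sum>i<n. \<Sum>j<n. P i j * Q i j)"

lemma gram_sq_le: "is_gram n P \<Longrightarrow> i < n \<Longrightarrow> j < n \<Longrightarrow> (P i j)\<^sup>2 \<le> P i i * P j j"
  unfolding is_gram_def using Cauchy_Schwarz_ineq_sum[of _ _ "{..<n}"] by (auto simp: power2_eq_square)

text \<open>The sum of all entries is the quadratic form at the all-ones vector.\<close>
lemma gram_sum_nonneg:
  assumes "is_gram n P" shows "(\<Sum>i<n. \<Sum>j<n. P i j) \<ge> 0"
proof -
  obtain W where W: "\<forall>i<n. \<forall>j<n. P i j = (\<Sum>k<n. W k i * W k j)"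
    using assms by (auto simp: is_gram_def)
  have "(\<Sum>i<n. \<Sum>j<n. P i j) = (\<Sum>i<n. \<Sum>j<n. \<Sum>k<n. W k i * W k j)" using W by simp
  also have "\<dots> = (\<Sum>i<n. \<Sum>k<n. \<Sum>j<n. W k i * W k j)"
    by (intro sum.cong refl sum.swap)
  also have "\<dots> = (\<Sum>k<n. \<Sum>i<n. \<Sum>j<n. W k i * W k j)" by (rule sum.swap)
  also have "\<dots> = (\<Sum>k<n. (\<Sum>i<n. W k i)\<^sup>2)" by (simp add: power2_eq_square sum_product)
  finally show ?thesis by (simp add: sum_nonneg)
qed

text \<open>
  Two matrices diagonal in the same orthonormal basis: the rank-one projections onto distinct basis
  vectors are orthogonal unit vectors for the Frobenius inner product.
\<close>
lemma frob_inner_spectral_sum: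
  fixes U :: "nat \<Rightarrow> nat \<Rightarrow> real"
  assumes orth: "\<And>k l. k < n \<Longrightarrow> l < n \<Longrightarrow> (\<Sum>i<n. U i k * U i l) = (if k = l then 1 else 0)"
  shows "frob_inner n (\<lambda>i j. \<Sum>k<n. f k * U i k * U j k) (\<lambda>i j. \<Sum>k<n. g k * U i k * U j k)
    = (\<Sum>k<n. f k * g k)"
proof -
  let ?h = "\<lambda>i j k l. f k * g l * (U i k * U i l) * (U j k * U j l)"
  have "frob_inner n (\<lambda>i j. \<Sum>k<n. f k * U i k * U j k) (\<lambda>i j. \<Sum>k<n. g k * U i k * U j k)
      = (\<Sum>i<n. \<Sum>j<n. \<Sum>k<n. \<Sum>l<n. ?h i j k l)"
    by (simp add: frob_inner_def sum_product mult_ac)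
  also have "\<dots> = (\<Sum>i<n. \<Sum>k<n. \<Sum>j<n. \<Sum>l<n. ?h i j k l)"
    by (intro sum.cong refl sum.swap)
  also have "\<dots> = (\<Sum>k<n. \<Sum>i<n. \<Sum>j<n. \<Sum>l<n. ?h i j k l)"
    by (rule sum.swap)
  also have "\<dots> = (\<Sum>k<n. \<Sum>i<n. \<Sum>l<n. \<Sum>j<n. ?h i j k l)"
    by (intro sum.cong refl sum.swap)
  also have "\<dots> = (\<Sum>k<n. \<Sum>l<n. \<Sum>i<n. \<Sum>j<n. ?h i j k l)"
    by (intro sum.cong refl sum.swap)
  also have "\<dots> = (\<Sum>k<n. \<Sum>l<n. f k * g l * (\<Sum>i<n. U i k * U i l)\<^sup>2)"
    unfolding power2_eq_square sum_product unfolding sum_distrib_left by (simp add: mult_ac)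
  also have "\<dots> = (\<Sum>k<n. f k * g k)"
    by (simp add: orth if_distrib[of "\<lambda>x. x\<^sup>2"] if_distrib[of "\<lambda>x. _ * x"] cong: if_cong)
  finally show ?thesis .
qed

lemma sum_filter_mset_eq_sum_nth:
  "(\<Sum>x\<in>#filter_mset Q (mset xs). g x) = (\<Sum>k<length xs. if Q (xs ! k) then g (xs ! k) else (0::real))"
proof -
  have "(\<Sum>x\<in>#filter_mset Q M. g x) = (\<Sum>x\<in>#M. if Q x then g x else 0)" for M
    by (induction M) auto
  then have "(\<Sum>x\<in>#filter_mset Q (mset xs). g x) = sum_list (map (\<lambda>x. if Q x then g x else 0) xs)"
    by (simp flip: sum_mset_sum_list mset_map)
  then show ?thesis
    by (simp add: sum_list_sum_nth atLeast0LessThan)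
qed

lemma proots_prod_linear_factors: "proots (\<Prod>e\<leftarrow>es. [:- e, 1:]) = mset (es :: real list)"
proof (induction es)
  case (Cons e es)
  have "(\<Prod>e\<leftarrow>es. [:- e, 1:]) \<noteq> 0" by (auto simp: prod_list_zero_iff)
  then have "proots ([:- e, 1:] * (\<Prod>e\<leftarrow>es. [:- e, 1:])) = {#e#} + mset es"
    using Cons by (subst proots_mult) auto
  then show ?case by simp
qed simp

text \<open>
  Replacing each eigenvalue \<open>x\<close> in the spectral decomposition by \<open>max x 0\<close> gives \<open>P\<close>, and by
  \<open>max (- x) 0\<close> gives \<open>N\<close>. The product of these two functions vanishes, whence orthogonality.
\<close>
lemma symmetric_mat_pos_neg_parts:
  fixes A :: "real mat"
  assumes A: "A \<in> carrier_mat n n" and sym: "transpose_mat A = A"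
  shows "\<exists>P N. is_gram n P \<and> is_gram n N \<and> (\<forall>i<n. \<forall>j<n. A $$ (i, j) = P i j - N i j) \<and> frob_inner n P N = 0
    \<and> frob_inner n P P = (\<Sum>l\<in>#filter_mset (\<lambda>l. l > 0) (proots (char_poly A)). l\<^sup>2)
    \<and> frob_inner n N N = (\<Sum>l\<in>#filter_mset (\<lambda>l. l < 0) (proots (char_poly A)). l\<^sup>2)"
proof -
  obtain U es where U: "U \<in> carrier_mat n n" and len: "length es = n" and UtU: "transpose_mat U * U = 1\<^sub>m n"
    and A_eq: "A = U * mat_diag n (\<lambda>k. es ! k) * transpose_mat U"
    and cp: "char_poly A = (\<Prod>e\<leftarrow>es. [:- e, 1:])"
    using real_spectral_theorem[OF A sym] by blast
  define u where "u i k = U $$ (i, k)" for i k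
  have orth: "(\<Sum>i<n. u i k * u i l) = (if k = l then 1 else 0)" if "k < n" "l < n" for k l
    using arg_cong[OF UtU, of "\<lambda>M. M $$ (k, l)"] that U
    by (simp add: u_def scalar_prod_def atLeast0LessThan)
  define part where "part f i j = (\<Sum>k<n. f (es ! k) * u i k * u j k)" for f :: "real \<Rightarrow> real" and i j
  have frob_part: "frob_inner n (part f) (part g) = (\<Sum>k<n. f (es ! k) * g (es ! k))" for f g
    using frob_inner_spectral_sum[OF orth, of "\<lambda>k. f (es ! k)" "\<lambda>k. g (es ! k)"] by (simp add: part_def[abs_def])
  have gram_part: "is_gram n (part f)" if "\<And>x. f x \<ge> 0" for f
  proof -
    have sqrt_split: "f x * a * b = (sqrt (f x) * a) * (sqrt (f x) * b)" for x a b
    proof -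
      have "(sqrt (f x) * a) * (sqrt (f x) * b) = (sqrt (f x) * sqrt (f x)) * a * b"
        by (simp only: mult_ac)
      then show ?thesis using that by simp
    qed
    show ?thesis
      unfolding is_gram_def part_def sqrt_split
      by (rule exI[of _ "\<lambda>k i. sqrt (f (es ! k)) * u i k"]) blast
  qed
  define p where "p x = max x 0" for x :: real
  define q where "q x = max (- x) 0" for x :: real
  have "A $$ (i, j) = part p i j - part q i j" if "i < n" "j < n" for i j
  proof -
    have "A $$ (i, j) = (\<Sum>k<n. es ! k * u i k * u j k)"
      unfolding A_eq mat_diag_mult_right[OF U] using U that
      by (simp add: u_def scalar_prod_def atLeast0LessThan mult_ac)
    also have "\<dots> = part p i j - part q i j"
      unfolding part_def sum_subtractf[symmetric]
      by (intro sum.cong refl) (auto simp: p_def q_def max_def algebra_simps)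
    finally show ?thesis .
  qed
  moreover have "frob_inner n (part p) (part q) = 0"
    unfolding frob_part by (intro sum.neutral) (auto simp: p_def q_def max_def)
  moreover have "frob_inner n (part p) (part p) = (\<Sum>l\<in>#filter_mset (\<lambda>l. l > 0) (proots (char_poly A)). l\<^sup>2)"
    unfolding frob_part cp proots_prod_linear_factors sum_filter_mset_eq_sum_nth len
    by (intro sum.cong refl) (auto simp: p_def power2_eq_square)
  moreover have "frob_inner n (part q) (part q) = (\<Sum>l\<in>#filter_mset (\<lambda>l. l < 0) (proots (char_poly A)). l\<^sup>2)"
    unfolding frob_part cp proots_prod_linear_factors sum_filter_mset_eq_sum_nth len
    by (intro sum.cong refl) (auto simp: q_def power2_eq_square)
  ultimately show ?thesis
    using gram_part[of p] gram_part[of q] unfolding p_def q_def by (metis max.cobounded2)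
qed

section \<open>Orthogonal positive semidefinite matrices with equal diagonals\<close>

text \<open>
  Let \<open>S\<close> be the sum of the squares of the common diagonal entries \<open>a\<^sub>i\<close>, and let \<open>p\<close>, \<open>q\<close> be the sums
  of the squares of the off-diagonal entries of \<open>P\<close>, \<open>N\<close>. Orthogonality says that the off-diagonal
  parts have inner product \<open>- S\<close>, so \<open>S\<^sup>2 \<le> p q\<close> by Cauchy-Schwarz. Semidefiniteness gives
  \<open>P\<^sub>i\<^sub>j\<^sup>2 \<le> a\<^sub>i a\<^sub>j \<le> (a\<^sub>i\<^sup>2 + a\<^sub>j\<^sup>2) / 2\<close>, and summing over all \<open>i\<close>, \<open>j\<close> gives \<open>S + p \<le> n S\<close>.
  The two bounds combine to \<open>S + p \<le> (n - 1) (S + q)\<close>.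

  If equality holds and \<open>P\<close> is nonzero, both bounds are tight: all \<open>a\<^sub>i\<close> agree and every \<open>P\<^sub>i\<^sub>j\<^sup>2\<close> equals \<open>a\<^sub>i\<^sup>2\<close>, while the
  off-diagonal parts of \<open>P\<close> and \<open>N\<close> are proportional with a negative factor. Hence
  \<open>P\<^sub>i\<^sub>j\<close> and \<open>N\<^sub>i\<^sub>j\<close> are nonzero of opposite sign.
\<close>
lemma
  assumes P: "is_gram n P" and N: "is_gram n N"
    and diag: "\<And>i. i < n \<Longrightarrow> P i i = N i i" and ortho: "frob_inner n P N = 0"
  shows gram_orthogonal_le: "frob_inner n P P \<le> (real n - 1) * frob_inner n N N"
    and gram_orthogonal_eq_imp: "\<lbrakk>frob_inner n P P = (real n - 1) * frob_inner n N N; frob_inner n P P \<noteq> 0;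
      i < n; j < n; i \<noteq> j\<rbrakk> \<Longrightarrow> P i j \<noteq> N i j"
proof -
  define E where "E = Sigma {..<n} (\<lambda>i. {..<n} - {i})"
  define S where "S = (\<Sum>i<n. (P i i)\<^sup>2)"
  define p where "p = (\<Sum>(i, j)\<in>E. (P i j)\<^sup>2)"
  define q where "q = (\<Sum>(i, j)\<in>E. (N i j)\<^sup>2)"
  have fin: "finite E" by (simp add: E_def)
  have frob_split: "frob_inner n X Y = (\<Sum>i<n. X i i * Y i i) + (\<Sum>(i, j)\<in>E. X i j * Y i j)" for X Y
  proof -
    have "frob_inner n X Y = (\<Sum>i<n. X i i * Y i i + (\<Sum>j\<in>{..<n} - {i}. X i j * Y i j))"
      unfolding frob_inner_def by (intro sum.cong refl) (simp add: sum.remove)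
    then show ?thesis by (simp add: E_def sum.distrib sum.Sigma)
  qed
  have PP: "frob_inner n P P = S + p" and NN: "frob_inner n N N = S + q"
    using diag by (auto simp: frob_split S_def p_def q_def power2_eq_square)
  have PN: "(\<Sum>(i, j)\<in>E. P i j * N i j) = - S"
    using ortho diag by (simp add: frob_split S_def power2_eq_square)
  have nonneg: "S \<ge> 0" "p \<ge> 0" "q \<ge> 0"
    by (auto simp: S_def p_def q_def intro!: sum_nonneg)
  have entry: "(P i j)\<^sup>2 \<le> ((P i i)\<^sup>2 + (P j j)\<^sup>2) / 2" if "i < n" "j < n" for i j
    using gram_sq_le[OF P that] zero_le_power2[of "P i i - P j j"] by (simp add: power2_diff)
  have "(\<Sum>i<n. \<Sum>j<n. ((P i i)\<^sup>2 + (P j j)\<^sup>2) / 2 - (P i j)\<^sup>2) = n * S - (S + p)"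
  proof -
    have "(\<Sum>i<n. \<Sum>j<n. ((P i i)\<^sup>2 + (P j j)\<^sup>2) / 2) = n * S"
      by (simp add: S_def sum.distrib flip: sum_divide_distrib sum_distrib_left)
    then show ?thesis
      unfolding PP[symmetric] by (simp add: frob_inner_def sum_subtractf power2_eq_square)
  qed
  note gap_sum = this
  have p_le: "p \<le> (real n - 1) * S"
    using sum_nonneg[of "{..<n}" "\<lambda>i. \<Sum>j<n. ((P i i)\<^sup>2 + (P j j)\<^sup>2) / 2 - (P i j)\<^sup>2"] entry gap_sum
    by (force simp: algebra_simps intro: sum_nonneg)
  have S_le: "S\<^sup>2 \<le> p * q"
    using Cauchy_Schwarz_ineq_sum[of "\<lambda>(i, j). P i j" "\<lambda>(i, j). N i j" E] PN
    by (simp add: p_def q_def case_prod_beta)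
  define gap where "gap = (real n - 1) * (S + q) - (S + p)"
  \<comment> \<open>Multiplying by \<open>p\<close> displays the gap as a combination of the slacks in the two bounds.\<close>
  have gap: "p * gap = (real n - 1) * (p * q - S\<^sup>2) + ((real n - 1) * S - p) * (S + p)"
    by (simp add: gap_def power2_eq_square algebra_simps)
  show "frob_inner n P P \<le> (real n - 1) * frob_inner n N N"
  proof (cases "n = 0")
    case True
    then show ?thesis by (simp add: frob_inner_def)
  next
    case False
    then have n: "real n - 1 \<ge> 0" by simp
    have "gap \<ge> 0"
    proof (cases "p = 0")
      case True
      then have "S = 0" using S_le by simp
      then show ?thesis using True nonneg n by (simp add: gap_def)
    next
      case False
      have "p * gap \<ge> 0"
        unfolding gap using n S_le p_le nonneg by simp
      then show ?thesis using False nonneg by (simp add: zero_le_mult_iff)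
    qed
    then show ?thesis by (simp add: gap_def PP NN)
  qed
  assume eq: "frob_inner n P P = (real n - 1) * frob_inner n N N" and nz: "frob_inner n P P \<noteq> 0"
    and ij: "i < n" "j < n" "i \<noteq> j"
  have n: "real n - 1 > 0" using ij by simp
  have S_pos: "S > 0"
    using nz p_le nonneg by (cases "S = 0") (auto simp: PP)
  have "gap = 0" using eq by (simp add: gap_def PP NN)
  then have pq: "p * q = S\<^sup>2" and p_eq: "p = (real n - 1) * S"
  proof -
    have "(real n - 1) * (p * q - S\<^sup>2) + ((real n - 1) * S - p) * (S + p) = 0"
      using gap \<open>gap = 0\<close> by simp
    moreover have "(real n - 1) * (p * q - S\<^sup>2) \<ge> 0" "((real n - 1) * S - p) * (S + p) \<ge> 0"
      using n S_le p_le nonneg by auto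
    ultimately have "(real n - 1) * (p * q - S\<^sup>2) = 0" "((real n - 1) * S - p) * (S + p) = 0"
      by linarith+
    then show "p * q = S\<^sup>2" "p = (real n - 1) * S"
      using n S_pos nonneg by auto
  qed
  \<comment> \<open>Equality in Cauchy-Schwarz, in the form of a vanishing sum of squares.\<close>
  have "(\<Sum>(i, j)\<in>E. (S * P i j + p * N i j)\<^sup>2)
      = (\<Sum>(i, j)\<in>E. S\<^sup>2 * (P i j)\<^sup>2 + 2 * S * p * (P i j * N i j) + p\<^sup>2 * (N i j)\<^sup>2)"
    by (intro sum.cong refl) (auto simp: power2_eq_square algebra_simps)
  also have "\<dots> = S\<^sup>2 * (\<Sum>(i, j)\<in>E. (P i j)\<^sup>2) + 2 * S * p * (\<Sum>(i, j)\<in>E. P i j * N i j)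
      + p\<^sup>2 * (\<Sum>(i, j)\<in>E. (N i j)\<^sup>2)"
    by (simp add: case_prod_beta sum.distrib flip: sum_distrib_left)
  also have "\<dots> = S\<^sup>2 * p + 2 * S * p * (- S) + p\<^sup>2 * q"
    by (simp only: PN p_def q_def)
  also have "\<dots> = p * (p * q - S\<^sup>2)" by (simp add: power2_eq_square algebra_simps)
  also have "\<dots> = 0" by (simp add: pq)
  finally have sq_sum: "(\<Sum>(i, j)\<in>E. (S * P i j + p * N i j)\<^sup>2) = 0" .
  have "(case (i, j) of (i, j) \<Rightarrow> (S * P i j + p * N i j)\<^sup>2) = 0"
    by (rule sum_nonneg_0[OF fin _ sq_sum]) (use ij in \<open>auto simp: E_def\<close>)
  then have proportional: "S * P i j + p * N i j = 0" by simp
  have entry_eq: "(P k l)\<^sup>2 = ((P k k)\<^sup>2 + (P l l)\<^sup>2) / 2" if kl: "k < n" "l < n" for k l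
  proof -
    define r where "r i j = ((P i i)\<^sup>2 + (P j j)\<^sup>2) / 2 - (P i j)\<^sup>2" for i j
    have r_nonneg: "r i j \<ge> 0" if "i < n" "j < n" for i j
      using entry[OF that] by (simp add: r_def)
    have sum_r: "(\<Sum>i<n. \<Sum>j<n. r i j) = 0"
      unfolding r_def gap_sum p_eq by (simp add: algebra_simps)
    have row_r: "(\<Sum>j<n. r k j) = 0"
      by (rule sum_nonneg_0[OF _ _ sum_r]) (use kl r_nonneg in \<open>auto intro!: sum_nonneg\<close>)
    have "r k l = 0"
      by (rule sum_nonneg_0[OF _ _ row_r]) (use kl r_nonneg in auto)
    then show ?thesis by (simp add: r_def)
  qed
  have const: "P k k = P l l" if "k < n" "l < n" for k l
  proof -
    have "(P k k - P l l)\<^sup>2 \<le> 0"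
      using gram_sq_le[OF P that] entry_eq[OF that] by (simp add: power2_diff)
    then show ?thesis by simp
  qed
  show "P i j \<noteq> N i j"
  proof
    assume "P i j = N i j"
    then have "(S + p) * P i j = 0" using proportional by (simp add: algebra_simps)
    then have "P i j = 0" using S_pos nonneg by auto
    then have "(P i i)\<^sup>2 + (P j j)\<^sup>2 = 0" using entry_eq[of i j] ij by simp
    then have "P i i = 0" by (simp add: sum_power2_eq_zero_iff)
    then have "P k k = 0" if "k < n" for k
      using const[OF that ij(1)] by simp
    then have "S = 0" by (simp add: S_def)
    then show False using S_pos by simp
  qed
qed

section \<open>Square energies of a graph\<close>

lemma pair_graph_graph_complement:
  assumes "pair_graph G" shows "pair_graph (graph_complement G)"
proof -
  interpret pair_graph G by fact
  have sym: "(v, u) \<in> parcs G" if "(u, v) \<in> parcs G" for u v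
    using that pair_sym_arcs by (auto simp: symmetric_def elim: symE)
  have sub: "parcs (graph_complement G) \<subseteq> pverts G \<times> pverts G"
    by (auto simp: graph_complement_def)
  show ?thesis
  proof unfold_locales
    show "finite (parcs (graph_complement G))"
      using finite_subset[OF sub] pair_finite_verts by simp
  qed (use pair_finite_verts sym in \<open>auto simp: graph_complement_def symmetric_def intro!: symI\<close>)
qed

lemma parcs_subset_off_diagonal:
  assumes "pair_graph G"
  shows "parcs G \<subseteq> {(u, v) \<in> pverts G \<times> pverts G. u \<noteq> v}"
proof
  interpret pair_graph G by fact
  fix e assume "e \<in> parcs G"
  then show "e \<in> {(u, v) \<in> pverts G \<times> pverts G. u \<noteq> v}"
    using in_arcsD1[of "fst e" "snd e"] in_arcsD2[of "fst e" "snd e"] pair_no_loops[of e]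
    by (cases e) auto
qed

lemma
  assumes "pair_graph G" "card (pverts G) = n"
  shows adjacency_matrix_carrier: "adjacency_matrix G \<in> carrier_mat n n"
    and adjacency_matrix_symmetric: "transpose_mat (adjacency_matrix G) = adjacency_matrix G"
    and adjacency_matrix_01: "i < n \<Longrightarrow> j < n \<Longrightarrow> adjacency_matrix G $$ (i, j) \<in> {0, 1}"
    and adjacency_matrix_diag: "i < n \<Longrightarrow> adjacency_matrix G $$ (i, i) = 0"
    and adjacency_matrix_sum: "(\<Sum>i<n. \<Sum>j<n. adjacency_matrix G $$ (i, j)) = real (card (parcs G))"
    and adjacency_matrix_all_adjacent: "(\<And>i j. i < n \<Longrightarrow> j < n \<Longrightarrow> i \<noteq> j \<Longrightarrow> adjacency_matrix G $$ (i, j) \<noteq> 0)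
      \<Longrightarrow> parcs G = {(u, v) \<in> pverts G \<times> pverts G. u \<noteq> v}"
proof -
  interpret pair_graph G by fact
  define vs where "vs = vertex_enum G"
  have "\<exists>vs. distinct vs \<and> set vs = pverts G"
    using finite_distinct_list[OF pair_finite_verts] by auto
  then have vs: "distinct vs" "set vs = pverts G"
    unfolding vs_def vertex_enum_def by (metis (mono_tags, lifting) someI_ex)+
  have len: "length vs = n"
    using vs assms(2) distinct_card by force
  have sym: "(v, u) \<in> parcs G" if "(u, v) \<in> parcs G" for u v
    using that pair_sym_arcs by (auto simp: symmetric_def elim: symE)
  have A: "adjacency_matrix G = mat n n (\<lambda>(i, j). of_bool ((vs ! i, vs ! j) \<in> parcs G))"
    by (auto simp: adjacency_matrix_def Let_def len simp flip: vs_def intro!: eq_matI)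
  show "adjacency_matrix G \<in> carrier_mat n n" by (simp add: A)
  show "transpose_mat (adjacency_matrix G) = adjacency_matrix G"
    unfolding A by (rule eq_matI) (use sym in auto)
  show "i < n \<Longrightarrow> j < n \<Longrightarrow> adjacency_matrix G $$ (i, j) \<in> {0, 1}" by (simp add: A)
  show "i < n \<Longrightarrow> adjacency_matrix G $$ (i, i) = 0"
    using pair_no_loops[of "(vs ! i, vs ! i)"] by (auto simp: A)
  have reindex: "(\<Sum>i<n. f (vs ! i)) = (\<Sum>v\<in>pverts G. f v)" for f :: "'a \<Rightarrow> real"
    using sum.reindex_bij_betw[OF bij_betw_nth[OF vs(1) _ vs(2)[symmetric]], of "{..<n}" f] len by simp
  have "(\<Sum>i<n. \<Sum>j<n. adjacency_matrix G $$ (i, j))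
      = (\<Sum>i<n. \<Sum>j<n. of_bool ((vs ! i, vs ! j) \<in> parcs G))"
    by (simp add: A)
  also have "\<dots> = (\<Sum>u\<in>pverts G. \<Sum>v\<in>pverts G. of_bool ((u, v) \<in> parcs G))"
    using reindex[of "\<lambda>u. \<Sum>v\<in>pverts G. of_bool ((u, v) \<in> parcs G)"]
    by (simp add: reindex[of "\<lambda>v. of_bool ((vs ! _, v) \<in> parcs G)"])
  also have "\<dots> = (\<Sum>e\<in>pverts G \<times> pverts G. of_bool (e \<in> parcs G))"
    by (rule trans[OF sum.cartesian_product]) (auto intro!: sum.cong)
  also have "\<dots> = card ((pverts G \<times> pverts G) \<inter> parcs G)"
    using pair_finite_verts by (simp add: of_bool_def sum.If_cases)
  also have "(pverts G \<times> pverts G) \<inter> parcs G = parcs G"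
    using in_arcsD1 in_arcsD2 by auto
  finally show "(\<Sum>i<n. \<Sum>j<n. adjacency_matrix G $$ (i, j)) = real (card (parcs G))" .
  assume adj: "\<And>i j. i < n \<Longrightarrow> j < n \<Longrightarrow> i \<noteq> j \<Longrightarrow> adjacency_matrix G $$ (i, j) \<noteq> 0"
  have "(u, v) \<in> parcs G" if "u \<in> pverts G" "v \<in> pverts G" "u \<noteq> v" for u v
  proof -
    obtain i j where "i < n" "j < n" "u = vs ! i" "v = vs ! j"
      using \<open>u \<in> pverts G\<close> \<open>v \<in> pverts G\<close> vs(2) len by (metis in_set_conv_nth)
    then show ?thesis using adj[of i j] \<open>u \<noteq> v\<close> by (auto simp: A)
  qed
  then show "parcs G = {(u, v) \<in> pverts G \<times> pverts G. u \<noteq> v}"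
    using parcs_subset_off_diagonal[OF assms(1)] by auto
qed

lemma card_off_diagonal:
  assumes "finite V"
  shows "card {(u, v) \<in> V \<times> V. u \<noteq> v} = card V * (card V - 1)"
proof -
  have "{(u, v) \<in> V \<times> V. u \<noteq> v} = Sigma V (\<lambda>u. V - {u})" by auto
  then show ?thesis using assms by simp
qed

text \<open>
  All facts about the spectrum that enter the theorem, for a single graph. For the complete graph,
  the entries of \<open>A = P - N\<close> sum to \<open>n (n - 1)\<close>; those of \<open>N\<close> have a nonnegative sum, so those of \<open>P\<close>
  sum to at least \<open>n (n - 1)\<close>, and Cauchy-Schwarz against the all-ones matrix, whose norm is \<open>n\<close>,
  bounds the norm of \<open>P\<close> from below by \<open>n - 1\<close>.
\<close>
lemma
  assumes G: "pair_graph G" "card (pverts G) = n"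
  shows square_energies_sum: "pos_square_energy G + neg_square_energy G = card (parcs G)"
    and pos_square_energy_le: "pos_square_energy G \<le> (real n - 1) * neg_square_energy G"
    and neg_square_energy_le: "neg_square_energy G \<le> (real n - 1) * pos_square_energy G"
    and square_energy_eq_imp:
      "pos_square_energy G = (real n - 1) * neg_square_energy G
        \<or> neg_square_energy G = (real n - 1) * pos_square_energy G
      \<Longrightarrow> edgeless G \<or> parcs G = {(u, v) \<in> pverts G \<times> pverts G. u \<noteq> v}"
    and pos_square_energy_complete_ge: "parcs G = {(u, v) \<in> pverts G \<times> pverts G. u \<noteq> v}
      \<Longrightarrow> n \<noteq> 0 \<Longrightarrow> (real n - 1)\<^sup>2 \<le> pos_square_energy G"
    and pos_square_energy_nonneg: "pos_square_energy G \<ge> 0"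
    and neg_square_energy_nonneg: "neg_square_energy G \<ge> 0"
proof -
  have fin: "finite (pverts G)" and fin_arcs: "finite (parcs G)"
    using G(1) by (simp_all add: pair_graph_def pair_digraph_def pair_fin_digraph.pair_finite_arcs pair_fin_digraph.pair_finite_verts)
  note A = adjacency_matrix_carrier[OF G] and sym = adjacency_matrix_symmetric[OF G]
  obtain P N where P: "is_gram n P" and N: "is_gram n N"
    and A_eq: "\<forall>i<n. \<forall>j<n. adjacency_matrix G $$ (i, j) = P i j - N i j"
    and ortho: "frob_inner n P N = 0"
    and PP: "frob_inner n P P = pos_square_energy G" and NN: "frob_inner n N N = neg_square_energy G"
    using symmetric_mat_pos_neg_parts[OF A sym]
    unfolding pos_square_energy_def neg_square_energy_def graph_eigenvalues_def by metis
  have diag: "P i i = N i i" if "i < n" for i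
    using A_eq that adjacency_matrix_diag[OF G, of i] by auto
  have ortho': "frob_inner n N P = 0" using ortho by (simp add: frob_inner_def mult.commute)
  show pos_le: "pos_square_energy G \<le> (real n - 1) * neg_square_energy G"
    using gram_orthogonal_le[OF P N diag ortho] by (simp add: PP NN)
  show neg_le: "neg_square_energy G \<le> (real n - 1) * pos_square_energy G"
    using gram_orthogonal_le[OF N P diag[symmetric] ortho'] by (simp add: PP NN)
  show pos: "pos_square_energy G \<ge> 0" and neg: "neg_square_energy G \<ge> 0"
    unfolding PP[symmetric] NN[symmetric] by (auto simp: frob_inner_def intro!: sum_nonneg)
  have "pos_square_energy G + neg_square_energy G = frob_inner n P P + frob_inner n N N - 2 * frob_inner n P N"
    by (simp add: PP NN ortho)
  also have "\<dots> = (\<Sum>i<n. \<Sum>j<n. P i j * P i j + N i j * N i j - 2 * (P i j * N i j))"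
    by (simp add: frob_inner_def sum.distrib sum_subtractf flip: sum_distrib_left)
  also have "\<dots> = (\<Sum>i<n. \<Sum>j<n. (P i j - N i j)\<^sup>2)"
    by (intro sum.cong refl) (simp add: power2_eq_square algebra_simps)
  \<comment> \<open>Entries are 0 or 1, hence equal to their squares.\<close>
  also have "\<dots> = (\<Sum>i<n. \<Sum>j<n. adjacency_matrix G $$ (i, j))"
    using A_eq adjacency_matrix_01[OF G] by (intro sum.cong refl) (force simp: power2_eq_square)
  also have "\<dots> = card (parcs G)" by (rule adjacency_matrix_sum[OF G])
  finally show total: "pos_square_energy G + neg_square_energy G = card (parcs G)" .
  {
    assume eq: "pos_square_energy G = (real n - 1) * neg_square_energy G
        \<or> neg_square_energy G = (real n - 1) * pos_square_energy G"
    show "edgeless G \<or> parcs G = {(u, v) \<in> pverts G \<times> pverts G. u \<noteq> v}"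
    proof (cases "edgeless G")
      case False
      have "card (parcs G) > 0"
        using False fin_arcs by (simp add: edgeless_def card_gt_0_iff)
      then have "pos_square_energy G + neg_square_energy G > 0" using total by simp
      then have nz: "frob_inner n P P \<noteq> 0" "frob_inner n N N \<noteq> 0"
        using pos_le neg_le pos neg by (auto simp: PP NN)
      have "P i j \<noteq> N i j" if "i < n" "j < n" "i \<noteq> j" for i j
        using eq gram_orthogonal_eq_imp[OF P N diag ortho _ nz(1) that]
          gram_orthogonal_eq_imp[OF N P diag[symmetric] ortho' _ nz(2) that]
        unfolding PP NN by metis
      then have "parcs G = {(u, v) \<in> pverts G \<times> pverts G. u \<noteq> v}"
        using A_eq by (intro adjacency_matrix_all_adjacent[OF G]) auto
      then show ?thesis by simp
    qed simp
  }
  assume complete: "parcs G = {(u, v) \<in> pverts G \<times> pverts G. u \<noteq> v}"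
  assume n: "n \<noteq> 0"
  show "(real n - 1)\<^sup>2 \<le> pos_square_energy G"
  proof -
    have "real n * (real n - 1) = card (parcs G)"
      unfolding complete card_off_diagonal[OF fin] G(2) using n by (simp add: of_nat_diff)
    also have "\<dots> = (\<Sum>i<n. \<Sum>j<n. P i j) - (\<Sum>i<n. \<Sum>j<n. N i j)"
      unfolding adjacency_matrix_sum[OF G, symmetric] using A_eq by (simp add: sum_subtractf)
    also have "\<dots> \<le> (\<Sum>i<n. \<Sum>j<n. P i j)"
      using gram_sum_nonneg[OF N] by simp
    finally have le: "real n * (real n - 1) \<le> (\<Sum>i<n. \<Sum>j<n. P i j)" .
    have "(real n)\<^sup>2 * (real n - 1)\<^sup>2 \<le> (\<Sum>i<n. \<Sum>j<n. P i j)\<^sup>2"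
      using power_mono[OF le, of 2] n by (simp add: power_mult_distrib)
    also have "\<dots> = (\<Sum>(i, j)\<in>{..<n} \<times> {..<n}. 1 * P i j)\<^sup>2"
      by (simp add: sum.cartesian_product)
    also have "\<dots> \<le> (\<Sum>(i, j)\<in>{..<n} \<times> {..<n}. 1) * (\<Sum>(i, j)\<in>{..<n} \<times> {..<n}. (P i j)\<^sup>2)"
      using Cauchy_Schwarz_ineq_sum[of "\<lambda>_. 1" "\<lambda>(i, j). P i j" "{..<n} \<times> {..<n}"] by (simp add: case_prod_beta)
    also have "\<dots> = (real n)\<^sup>2 * pos_square_energy G"
      by (simp add: frob_inner_def sum.cartesian_product power2_eq_square flip: PP)
    finally show ?thesis using n by simp
  qed
qed

lemma card_parcs_complement:
  assumes "pair_graph G" "card (pverts G) = n"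
  shows "card (parcs G) + card (parcs (graph_complement G)) = n * (n - 1)"
proof -
  interpret pair_graph G by fact
  let ?K = "{(u, v) \<in> pverts G \<times> pverts G. u \<noteq> v}"
  note sub = parcs_subset_off_diagonal[OF assms(1)]
  have "parcs (graph_complement G) = ?K - parcs G"
    by (auto simp: graph_complement_def)
  then have "card (parcs (graph_complement G)) = card ?K - card (parcs G)"
    using card_Diff_subset[OF pair_finite_arcs sub] by simp
  moreover have "finite ?K"
    using pair_finite_verts by (auto intro: finite_subset[of _ "pverts G \<times> pverts G"])
  then have "card (parcs G) \<le> card ?K"
    using sub by (rule card_mono)
  ultimately show ?thesis
    using card_off_diagonal[OF pair_finite_verts] assms(2) by simp
qed

section \<open>A graph and its complement\<close>

theorem corollary4p5:
  fixes G :: "'a pair_pre_digraph" and n :: nat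
  assumes "pair_graph G"
    and "card (pverts G) = n"
    and "n \<ge> 2"
  shows "pos_square_energy G + pos_square_energy (graph_complement G) \<le> (real n - 1)\<^sup>2
         \<and> neg_square_energy G + neg_square_energy (graph_complement G) \<le> (real n - 1)\<^sup>2
         \<and> (pos_square_energy G + pos_square_energy (graph_complement G) = (real n - 1)\<^sup>2
           \<longleftrightarrow> complete_digraph n (with_proj G) \<or> edgeless G)
         \<and> (neg_square_energy G + neg_square_energy (graph_complement G) = (real n - 1)\<^sup>2
           \<longleftrightarrow> n = 2)"
proof -
  let ?H = "graph_complement G"
  let ?K = "{(u, v) \<in> pverts G \<times> pverts G. u \<noteq> v}"
  define s t s' t' where defs: "s = pos_square_energy G" "t = neg_square_energy G"
    "s' = pos_square_energy ?H" "t' = neg_square_energy ?H"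
  note G = assms(1,2)
  have verts_H: "pverts ?H = pverts G" by (simp add: graph_complement_def)
  have H: "pair_graph ?H" "card (pverts ?H) = n"
    using pair_graph_graph_complement[OF G(1)] G(2) unfolding verts_H by blast+
  have nonneg: "s \<ge> 0" "t \<ge> 0" "s' \<ge> 0" "t' \<ge> 0"
    unfolding defs using pos_square_energy_nonneg neg_square_energy_nonneg G H by blast+
  have ratio: "s \<le> (real n - 1) * t" "t \<le> (real n - 1) * s" "s' \<le> (real n - 1) * t'" "t' \<le> (real n - 1) * s'"
    unfolding defs using pos_square_energy_le neg_square_energy_le G H by blast+
  have "real (card (parcs G)) + card (parcs ?H) = real n * (real n - 1)"
    using card_parcs_complement[OF G] assms(3) by (simp add: of_nat_diff flip: of_nat_add)
  then have total: "s + t + (s' + t') = real n * (real n - 1)"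
    unfolding defs using square_energies_sum[OF G] square_energies_sum[OF H] by simp
  \<comment> \<open>\<open>n\<close> times the distance to the bound is the sum of the two slacks in \<open>ratio\<close>, so it is
    nonnegative, and it vanishes only if both slacks do.\<close>
  have gap_pos: "real n * ((real n - 1)\<^sup>2 - (s + s')) = ((real n - 1) * t - s) + ((real n - 1) * t' - s')"
  proof -
    have "real n * ((real n - 1)\<^sup>2 - (s + s')) = (real n - 1) * (real n * (real n - 1)) - real n * (s + s')"
      by (simp add: power2_eq_square algebra_simps)
    then show ?thesis unfolding total[symmetric] by (simp add: algebra_simps)
  qed
  have gap_neg: "real n * ((real n - 1)\<^sup>2 - (t + t')) = ((real n - 1) * s - t) + ((real n - 1) * s' - t')"
  proof -
    have "real n * ((real n - 1)\<^sup>2 - (t + t')) = (real n - 1) * (real n * (real n - 1)) - real n * (t + t')"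
      by (simp add: power2_eq_square algebra_simps)
    then show ?thesis unfolding total[symmetric] by (simp add: algebra_simps)
  qed
  have n: "real n > 0" using assms(3) by simp
  have "real n * ((real n - 1)\<^sup>2 - (s + s')) \<ge> 0" "real n * ((real n - 1)\<^sup>2 - (t + t')) \<ge> 0"
    unfolding gap_pos gap_neg using ratio by auto
  then have le_pos: "s + s' \<le> (real n - 1)\<^sup>2" and le_neg: "t + t' \<le> (real n - 1)\<^sup>2"
    using n by (simp_all add: zero_le_mult_iff)
  have complete_iff: "complete_digraph n (with_proj G) \<longleftrightarrow> parcs G = ?K"
  proof -
    have "finite (pverts G)" using assms by (auto intro: card_ge_0_finite)
    then show ?thesis using G(2) by (auto simp: complete_digraph_pair_def)
  qed
  have extremal: "edgeless G \<or> parcs G = ?K" if "s + s' = (real n - 1)\<^sup>2 \<or> t + t' = (real n - 1)\<^sup>2"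
  proof -
    have "s = (real n - 1) * t \<or> t = (real n - 1) * s"
      using that gap_pos gap_neg ratio by auto
    then show ?thesis
      using square_energy_eq_imp[OF G] by (simp add: defs)
  qed
  have extremal_pos: "s + s' = (real n - 1)\<^sup>2" if "edgeless G \<or> parcs G = ?K"
  proof -
    have "parcs ?H = {(u, v) \<in> pverts ?H \<times> pverts ?H. u \<noteq> v}" if "edgeless G"
      using that by (auto simp: graph_complement_def edgeless_def)
    then have "(real n - 1)\<^sup>2 \<le> s \<or> (real n - 1)\<^sup>2 \<le> s'"
      using that pos_square_energy_complete_ge[OF G] pos_square_energy_complete_ge[OF H] assms(3)
      unfolding defs by force
    then show ?thesis using le_pos nonneg by linarith
  qed
  have "t + t' = (real n - 1)\<^sup>2 \<longleftrightarrow> n = 2"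
  proof
    assume eq: "t + t' = (real n - 1)\<^sup>2"
    \<comment> \<open>Equality for the negative sum makes \<open>G\<close> complete or edgeless, which gives equality for
      the positive sum as well; but by \<open>total\<close> the two sums add up to \<open>n (n - 1)\<close>.\<close>
    then have "s + s' = (real n - 1)\<^sup>2" using extremal extremal_pos by blast
    then have "(real n - 1) * (2 * (real n - 1) - real n) = 0"
      using eq total by (simp add: power2_eq_square algebra_simps)
    then show "n = 2" using assms(3) by auto
  next
    assume "n = 2"
    \<comment> \<open>Here \<open>ratio\<close> says \<open>s = t\<close> and \<open>s' = t'\<close>.\<close>
    then show "t + t' = (real n - 1)\<^sup>2" using ratio total by simp
  qed
  then show ?thesis
    unfolding complete_iff defs[symmetric] using le_pos le_neg extremal extremal_pos by blast
qed
end
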